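(* Let $(X,\tau,\le)$ be a separable linearly ordered topological space, let $\mu$ be a probability measure on the Borel $\sigma$-algebra of $(X,\tau)$, let $F$ be its cumulative distribution function and let $G$ be the pseudo-inverse of $F$. Then: (1) $G(F(x))\le x$ for each $x\in X$ such that $G$ is defined at $F(x)$. (2) $F(G(r))\ge r$ for each $r\in[0,1]$ such that $G$ is defined at $r$.
   Context: A linearly ordered topological space (LOTS) is a triple $(X,\tau,\le)$ where $\le$ is a linear order on $X$ and $\tau$ is the order topology, i.e. the topology with subbasis $\{\{x\in X:x<a\}:a\in X\}\cup\{\{x\in X:x>a\}:a\in X\}$. Separable means having a countable $\tau$-dense subset. The cumulative distribution function of $\mu$ is $F:X\to[0,1]$, $F(x)=\mu(\{y\in X:y\le x\})$. The pseudo-inverse of $F$ is the partial function $G$ from $[0,1]$ to $X$ given by $G(r)=\inf\{y\in X:F(y)\ge r\}$, defined exactly at those $r\in[0,1]$ for which this infimum (greatest lower bound in $X$) exists. *)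

theory Defs
  imports "HOL-Probability.Probability_Measure" "HOL-Library.Lub_Glb"
begin

definition lots_cdf :: "'a::linorder_topology measure \<Rightarrow> 'a \<Rightarrow> real"
  where "lots_cdf M x = measure M {y. y \<le> x}"

text \<open>
  The pseudo-inverse is a partial function: \<open>Inf\<close> is not available for a general linear order,
  so \<open>None\<close> stands for ``undefined'', i.e. for \<open>r\<close> outside the unit interval or an infimum that
  does not exist. The infimum is taken in the whole order, so for an empty set it is the greatest
  element of the type, if there is one. In a linear order \<^const>\<open>isGlb\<close> determines its argument
  uniquely.
\<close>
definition pseudo_inverse :: "('a::linorder_topology \<Rightarrow> real) \<Rightarrow> real \<rightharpoonup> 'a"
  where "pseudo_inverse F r =
    (if r \<in> {0..1} \<and> (\<exists>g. isGlb UNIV {y. F y \<ge> r} g)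
     then Some (THE g. isGlb UNIV {y. F y \<ge> r} g) else None)"

end

theory Submission
  imports Defs
begin

text \<open>
  Write \<open>S = {y. r \<le> F y}\<close>, an upward closed set. Part (1) is immediate: \<open>x\<close> itself belongs to
  \<open>{y. F x \<le> F y}\<close>, so the infimum of that set lies below \<open>x\<close>.

  For part (2), let \<open>g\<close> be the infimum of \<open>S\<close>, and suppose that \<open>F g < r\<close>, i.e. that the infimum
  is not attained. Every point above \<open>g\<close> then lies in \<open>S\<close>, and no such point is an immediate
  successor of \<open>g\<close>, since it would be a larger lower bound of \<open>S\<close>. There are points above \<open>g\<close>,
  since \<open>F\<close> has the value \<open>1\<close> at a greatest element. Here separability
  enters: a countable dense set meets every interval \<open>{g<..<y}\<close>, which gives a \<^emph>\<open>sequence\<close> that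
  decreases to \<open>g\<close> from strictly above (\<open>separable_decreasing_sequence\<close>). Countable additivity of
  the measure then makes \<open>F\<close> continuous along this sequence (\<open>lots_cdf_tendsto\<close>). The values of
  \<open>F\<close> on the sequence are at least \<open>r\<close>, hence so is \<open>F g\<close>, a contradiction.
\<close>

text \<open>
  The terms are the running minima of an enumeration of the points of a countable dense set that
  lie above \<open>g\<close>.
\<close>
lemma separable_decreasing_sequence:
  fixes g :: "'a::linorder_topology"
  assumes separable: "separable_space (euclidean :: 'a topology)"
    and not_top: "g < u"
    and no_succ: "\<And>y. g < y \<Longrightarrow> \<exists>z. g < z \<and> z < y"
  obtains e :: "nat \<Rightarrow> 'a"
  where "decseq e" "\<And>n. g < e n" "\<And>y. g < y \<Longrightarrow> \<exists>n. e n < y"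
proof -
  obtain C :: "'a set" where C: "countable C" "closure C = UNIV"
    using separable unfolding separable_space_def by auto
  define D where "D = C \<inter> {g<..}"
  have dense: "\<exists>d\<in>D. d < y" if "g < y" for y
  proof -
    have "{g<..<y} \<noteq> {}"
      using no_succ[OF that] by auto
    then have "{g<..<y} \<inter> closure C \<noteq> {}"
      using C by simp
    then have "{g<..<y} \<inter> C \<noteq> {}"
      by (simp add: open_Int_closure_eq_empty)
    then show ?thesis
      unfolding D_def by auto
  qed
  have "D \<noteq> {}"
    using dense[OF not_top] by auto
  have range_D: "range (from_nat_into D) = D"
    using \<open>D \<noteq> {}\<close> C by (intro range_from_nat_into) (auto simp: D_def)
  define e where "e n = Min (from_nat_into D ` {..n})" for n
  show ?thesis
  proof
    show "decseq e"
      unfolding e_def decseq_def by (auto intro!: Min_antimono)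
    show "g < e n" for n
    proof -
      have "e n \<in> from_nat_into D ` {..n}"
        unfolding e_def by (intro Min_in) auto
      then have "e n \<in> D"
        using range_D by blast
      then show ?thesis
        by (simp add: D_def)
    qed
    show "\<exists>n. e n < y" if y: "g < y" for y
    proof -
      obtain n where "from_nat_into D n < y"
        using dense[OF y] range_D by (metis imageE)
      moreover have "e n \<le> from_nat_into D n"
        unfolding e_def by (intro Min_le) auto
      ultimately show ?thesis
        by (meson le_less_trans)
    qed
  qed
qed

lemma lots_cdf_mono:
  assumes "prob_space M" "sets M = sets borel" "x \<le> y"
  shows "lots_cdf M x \<le> lots_cdf M y"
proof -
  interpret prob_space M by fact
  have "{..y} \<in> sets M"
    using assms(2) by simp
  with \<open>x \<le> y\<close> show ?thesis
    unfolding lots_cdf_def by (intro finite_measure_mono) (auto simp: atMost_def)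
qed

text \<open>
  The sets \<open>{..e n}\<close> decrease to \<open>{..g}\<close>, so this is continuity of the measure from above.
\<close>
lemma lots_cdf_tendsto:
  assumes "prob_space M" "sets M = sets borel"
    and dec: "decseq e" and above: "\<And>n. g < e n" and limit: "\<And>y. g < y \<Longrightarrow> \<exists>n. e n < y"
  shows "(\<lambda>n. lots_cdf M (e n)) \<longlonglongrightarrow> lots_cdf M g"
proof -
  interpret prob_space M by fact
  have "(\<lambda>n. measure M {..e n}) \<longlonglongrightarrow> measure M (\<Inter>n. {..e n})"
    using dec assms(2)
    by (intro finite_Lim_measure_decseq) (auto simp: decseq_def intro: order_trans)
  moreover have "(\<Inter>n. {..e n}) = {..g}"
  proof (intro equalityI subsetI)
    fix x assume "x \<in> (\<Inter>n. {..e n})"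
    then show "x \<in> {..g}"
      using limit[of x] by (auto simp: not_less[symmetric])
  next
    fix x assume "x \<in> {..g}"
    then show "x \<in> (\<Inter>n. {..e n})"
      using above by (auto intro: order_trans less_imp_le)
  qed
  ultimately show ?thesis
    unfolding lots_cdf_def atMost_def by simp
qed

lemma lots_cdf_ge_isGlb:
  fixes M :: "'a::linorder_topology measure"
  assumes separable: "separable_space (euclidean :: 'a topology)"
    and prob: "prob_space M" and borel: "sets M = sets borel"
    and "r \<le> 1" and glb: "isGlb UNIV {y. r \<le> lots_cdf M y} g"
  shows "r \<le> lots_cdf M g"
proof (rule ccontr)
  assume not_attained: "\<not> r \<le> lots_cdf M g"
  interpret prob_space M by fact
  have lower: "g \<le> y" if "r \<le> lots_cdf M y" for y
    using glb that by (auto simp: isGlb_def isLb_def greatestP_def setge_def)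
  have greatest: "l \<le> g" if "\<And>y. r \<le> lots_cdf M y \<Longrightarrow> l \<le> y" for l
    using glb that by (auto simp: isGlb_def isLb_def greatestP_def setle_def setge_def)
  have above_in: "r \<le> lots_cdf M y" if y: "g < y" for y
  proof -
    obtain s where "r \<le> lots_cdf M s" "s < y"
      using greatest[of y] y by (meson not_le)
    then show ?thesis
      using lots_cdf_mono[OF prob borel, of s y] by (meson less_imp_le order_trans)
  qed
  have no_succ: "\<exists>z. g < z \<and> z < y" if "g < y" for y
  proof (rule ccontr)
    assume no_between: "\<nexists>z. g < z \<and> z < y"
    have "y \<le> s" if "r \<le> lots_cdf M s" for s
    proof -
      have "g \<noteq> s"
        using not_attained that by auto
      with lower[OF that] no_between show ?thesis
        by (meson le_neq_trans not_le)
    qed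
    from greatest[OF this] that show False
      by simp
  qed
  have "\<exists>u. g < u"
  proof (rule ccontr)
    assume "\<nexists>u. g < u"
    then have "{y. y \<le> g} = space M"
      using sets_eq_imp_space_eq[OF borel] by (auto simp: not_less)
    then have "lots_cdf M g = 1"
      by (simp add: lots_cdf_def prob_space)
    with not_attained \<open>r \<le> 1\<close> show False
      by simp
  qed
  then obtain u where "g < u" ..
  obtain e where e: "decseq e" "\<And>n. g < e n" "\<And>y. g < y \<Longrightarrow> \<exists>n. e n < y"
    using separable_decreasing_sequence[OF separable \<open>g < u\<close> no_succ] by blast
  have "r \<le> lots_cdf M g"
    using lots_cdf_tendsto[OF prob borel e] above_in[OF e(2)]
    by (intro LIMSEQ_le_const) auto
  with not_attained show False ..
qed

lemma pseudo_inverse_SomeD: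
  assumes "pseudo_inverse F r = Some g"
  shows "r \<in> {0..1}" "isGlb UNIV {y. r \<le> F y} g"
proof -
  have r: "r \<in> {0..1}" and ex: "\<exists>g. isGlb UNIV {y. r \<le> F y} g"
    and g: "g = (THE g. isGlb UNIV {y. r \<le> F y} g)"
    using assms by (auto simp: pseudo_inverse_def split: if_splits)
  show "r \<in> {0..1}" by fact
  have "\<exists>!g. isGlb UNIV {y. r \<le> F y} g"
    using ex by (auto intro: isGlb_unique)
  from theI'[OF this] show "isGlb UNIV {y. r \<le> F y} g"
    by (simp add: g)
qed

theorem proposition6p4:
  fixes M :: "'a::linorder_topology measure"
    and F :: "'a \<Rightarrow> real"
    and G :: "real \<rightharpoonup> 'a"
  assumes separable: "separable_space (euclidean :: 'a topology)"
    and prob: "prob_space M"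
    and borel: "sets M = sets borel"
    and F: "F = lots_cdf M"
    and G: "G = pseudo_inverse F"
  shows "(\<forall>x. F x \<in> dom G \<longrightarrow> the (G (F x)) \<le> x) \<and>
         (\<forall>r\<in>{0..1}. r \<in> dom G \<longrightarrow> F (the (G r)) \<ge> r)"
proof (intro conjI allI ballI impI)
  fix x assume "F x \<in> dom G"
  then obtain g where g: "G (F x) = Some g" by auto
  then have "isGlb UNIV {y. F x \<le> F y} g"
    unfolding G by (rule pseudo_inverse_SomeD)
  then have "g \<le> x"
    by (auto simp: isGlb_def isLb_def greatestP_def setge_def)
  with g show "the (G (F x)) \<le> x" by simp
next
  fix r assume "r \<in> dom G"
  then obtain g where g: "G r = Some g" by auto
  then have "r \<in> {0..1}" "isGlb UNIV {y. r \<le> F y} g"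
    unfolding G by (rule pseudo_inverse_SomeD)+
  then have "r \<le> F g"
    unfolding F by (intro lots_cdf_ge_isGlb separable prob borel) auto
  with g show "F (the (G r)) \<ge> r" by simp
qed

end
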